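(* Let $W^\star\in\mathbb{R}^{d_1\times r^\star}$, $X^\star\in\mathbb{R}^{d_2\times r^\star}$, $Y^\star\in\mathbb{R}^{d_3\times r^\star}$ be full-rank matrices (full column rank $r^\star$), put $r=r^\star$, and let $F_{\mathrm{asym}}:\mathbb{R}^{d_1\times r}\times\mathbb{R}^{d_2\times r}\times\mathbb{R}^{d_3\times r}\to\mathbb{R}^{d_1\times d_2\times d_3}$, $F_{\mathrm{asym}}(W,X,Y)=\sum_{j=1}^rW_j\otimes X_j\otimes Y_j$. Write $N^\star=\|(W^\star,X^\star,Y^\star)\|_F$ and $\sigma^\star=\sigma_{(d_1+d_2+d_3-2)r}(\nabla F_{\mathrm{asym}}(W^\star,X^\star,Y^\star))$. Then $F_{\mathrm{asym}}$ is continuously differentiable and $$\|\nabla F_{\mathrm{asym}}(u)-\nabla F_{\mathrm{asym}}(\tilde u)\|_{\mathrm{op}}\le4\sqrt3\,N^\star\,\|u-\tilde u\|_F\quad\text{for all }u,\tilde u\in B_{N^\star}((W^\star,X^\star,Y^\star)).$$ Moreover, $F_{\mathrm{asym}}$ is locally strongly aligned at $(W^\star,X^\star,Y^\star)$ with $$\varepsilon_{x^\star}=\min\left\{R,\frac{\sigma^\star}{8\sqrt3\,N^\star},N^\star\right\},\qquad\delta(\rho)=\frac{\rho}{C},\qquad s=\frac12\,\sigma^\star$$ for some constants $R,C>0$ that depend only on $(W^\star,X^\star,Y^\star)$.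
   Context: $X_j$ is the $j$-th column of $X$; $(w\otimes x\otimes y)_{ijk}=w_ix_jy_k$; $\|\cdot\|_F$ is the $\ell_2$ norm of all entries of a matrix, tensor, or tuple of matrices, and these spaces carry the corresponding inner product. $\nabla F(x)$ is the derivative of $F$ at $x$ as a linear map, $\sigma_k(\cdot)$ the $k$-th largest singular value. Fix for each $x$ an SVD of $\nabla F(x)$ with singular values $\sigma_1^x\ge\sigma_2^x\ge\cdots$, and let $\Pi_j^x$ be the orthogonal projection onto the span of its top $j$ left singular vectors. $B_t(z)$ is the closed ball of radius $t$ around $z$, $\mathbb{R}_+$ the positive reals. $F$ is locally strongly aligned at $x^\star$ (with $z^\star=F(x^\star)$) with function $\delta:\mathbb{R}_+\to\mathbb{R}_+$ and scalars $\varepsilon_{x^\star},s>0$ if for all $\rho>0$: whenever $x\in B_{\varepsilon_{x^\star}}(x^\star)$ and $z=F(x)\in B_{\delta(\rho)}(z^\star)$, there is an index $j$ such that $\|(I-\Pi^x_j)(z-z^\star)\|\le\rho\|z-z^\star\|$ and $(\sigma^x_j)^2\ge s$.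
   Formalization: The value s = σ*/2 is false for σ* ≤ 1/2 (e.g. d1=d2=d3=r=1, W*=X*=Y*=1/2); alignment is proved with s = (σ*/2)² in all cases, and with s = σ*/2 when σ* > 1/2, with the same R, C, ε and δ. *)

theory Defs
  imports "HOL-Analysis.Analysis"
begin

definition orthogonal_projection :: "'a::euclidean_space set \<Rightarrow> 'a \<Rightarrow> 'a" where
  "orthogonal_projection S z = (THE p. p \<in> S \<and> (\<forall>w\<in>S. orthogonal (z - p) w))"

(* Thin singular value decomposition.  The min (DIM('a)) (DIM('b)) singular values are numbered
   from 1, as in the usual notation; values of u, \<sigma>, v at other indices are irrelevant. *)
definition is_svd ::
  "('a::euclidean_space \<Rightarrow> 'b::euclidean_space) \<Rightarrow> (nat \<Rightarrow> 'b) \<Rightarrow> (nat \<Rightarrow> real) \<Rightarrow> (nat \<Rightarrow> 'a) \<Rightarrow> bool"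
where
  "is_svd f u \<sigma> v \<longleftrightarrow>
     (let J = {1..min (DIM('a)) (DIM('b))} in
       (\<forall>i\<in>J. \<forall>j\<in>J. u i \<bullet> u j = (if i = j then 1 else 0)) \<and>
       (\<forall>i\<in>J. \<forall>j\<in>J. v i \<bullet> v j = (if i = j then 1 else 0)) \<and>
       (\<forall>i\<in>J. 0 \<le> \<sigma> i) \<and>
       (\<forall>i\<in>J. \<forall>j\<in>J. i \<le> j \<longrightarrow> \<sigma> j \<le> \<sigma> i) \<and>
       (\<forall>x. f x = (\<Sum>i\<in>J. (\<sigma> i * (v i \<bullet> x)) *\<^sub>R u i)))"

(* Only meaningful for f linear and 1 \<le> k \<le> min (DIM('a)) (DIM('b)). *)
definition singular_value :: "nat \<Rightarrow> ('a::euclidean_space \<Rightarrow> 'b::euclidean_space) \<Rightarrow> real" where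
  "singular_value k f = (THE t. \<exists>u \<sigma> v. is_svd f u \<sigma> v \<and> t = \<sigma> k)"

abbreviation deriv_at :: "('a::euclidean_space \<Rightarrow> 'b::euclidean_space) \<Rightarrow> 'a \<Rightarrow> 'a \<Rightarrow> 'b" where
  "deriv_at F x \<equiv> frechet_derivative F (at x)"

definition continuously_differentiable :: "('a::euclidean_space \<Rightarrow> 'b::euclidean_space) \<Rightarrow> bool" where
  "continuously_differentiable F \<longleftrightarrow>
     (\<exists>F'. (\<forall>x. (F has_derivative blinfun_apply (F' x)) (at x)) \<and> continuous_on UNIV F')"

(* A choice of SVD of the derivative of F at every point x.  Left and right singular vectors are
   not unique, so a statement about "the" fixed SVDs is made for an arbitrary such choice. *)
definition svd_choice ::
  "('a::euclidean_space \<Rightarrow> 'b::euclidean_space) \<Rightarrow>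
   ('a \<Rightarrow> nat \<Rightarrow> 'b) \<Rightarrow> ('a \<Rightarrow> nat \<Rightarrow> real) \<Rightarrow> ('a \<Rightarrow> nat \<Rightarrow> 'a) \<Rightarrow> bool"
where
  "svd_choice F u \<sigma> v \<longleftrightarrow> (\<forall>x. is_svd (deriv_at F x) (u x) (\<sigma> x) (v x))"

(* Here u x and \<sigma> x are the left singular vectors and singular values of the SVD fixed at x. *)
definition locally_strongly_aligned ::
  "('a::euclidean_space \<Rightarrow> 'b::euclidean_space) \<Rightarrow> ('a \<Rightarrow> nat \<Rightarrow> 'b) \<Rightarrow> ('a \<Rightarrow> nat \<Rightarrow> real) \<Rightarrow>
   'a \<Rightarrow> (real \<Rightarrow> real) \<Rightarrow> real \<Rightarrow> real \<Rightarrow> bool"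
where
  "locally_strongly_aligned F u \<sigma> xstar \<delta> \<epsilon> s \<longleftrightarrow>
     0 < \<epsilon> \<and> 0 < s \<and> (\<forall>\<rho>>0. 0 < \<delta> \<rho>) \<and>
     (\<forall>\<rho>>0. \<forall>x. x \<in> cball xstar \<epsilon> \<and> F x \<in> cball (F xstar) (\<delta> \<rho>) \<longrightarrow>
       (\<exists>j\<in>{1..min (DIM('a)) (DIM('b))}.
          norm ((F x - F xstar) - orthogonal_projection (span (u x ` {1..j})) (F x - F xstar))
            \<le> \<rho> * norm (F x - F xstar) \<and>
          s \<le> (\<sigma> x j)\<^sup>2))"

definition outer3 :: "real^'d1 \<Rightarrow> real^'d2 \<Rightarrow> real^'d3 \<Rightarrow> real^'d3^'d2^'d1" where
  "outer3 w x y = (\<chi> i j k. w $ i * x $ j * y $ k)"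

(* The norms and inner products of these iterated vector and product types are the entrywise
   l2 (Frobenius) ones. *)
definition F_asym ::
  "(real^'r^'d1) \<times> (real^'r^'d2) \<times> (real^'r^'d3) \<Rightarrow> real^'d3^'d2^'d1"
where
  "F_asym = (\<lambda>(W, X, Y). \<Sum>j\<in>UNIV. outer3 (column j W) (column j X) (column j Y))"

end

theory Submission
  imports Defs
begin

text \<open>Write \<open>k = (d\<^sub>1 + d\<^sub>2 + d\<^sub>3 - 2) r\<close>. The factorization map is a trilinear form evaluated on its argument,
  so that its derivative and second-order remainder are explicit; the Lipschitz bound
  (\<open>F_asym_deriv_Lipschitz\<close>) follows from \<open>norm (F_asym (A, B, C)) \<le> norm A * norm B * norm C\<close>.
  
  For the alignment, the index \<open>j = k\<close> works at every point near the reference factorization \<open>x\<close>. The map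
  is invariant under rescaling the columns of a triple, a group of dimension \<open>2r\<close>. Its
  orbits are met by a linear slice of dimension \<open>k\<close> through \<open>x\<close>, on whose directions the derivative
  at \<open>x\<close> is injective because the factors have full column rank (\<open>F_asym_deriv_inj_on_slice\<close>). Thus the
  \<open>k\<close>-th singular value at \<open>x\<close> is positive, and it stays bounded below nearby by Weyl's inequality
  (\<open>svd_Weyl\<close>). At nearby points the range of the derivative is the image of the slice directions and
  has dimension at most \<open>k\<close>, so it lies in the span of the first \<open>k\<close> left singular vectors
  (\<open>range_F_asym_deriv_eq_slice\<close>, \<open>range_subset_span_left_vectors\<close>).
  
  It remains to see that a secant \<open>F_asym p - F_asym x\<close> is close to the range of the derivative at \<open>p\<close>.
  After \<open>p\<close> is moved along its orbit into the slice, injectivity bounds the displacement \<open>h\<close> from \<open>x\<close> by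
  a multiple of the length of the secant, and Taylor's formula at the moved point leaves an error of order
  \<open>(norm h)\<^sup>2\<close> (\<open>F_asym_secant_near_tangent\<close>). The residual is thus at most \<open>C\<close> times the square of the length of
  the secant, which is at most \<open>\<rho>\<close> times that length as soon as the length is at most \<open>\<rho> / C\<close>.\<close>

section \<open>Orthonormal families and orthogonal projections\<close>
lemma orthonormal_inner_sum:
  fixes v :: "'i \<Rightarrow> 'a::real_inner"
  assumes "finite I" "j \<in> I"
    and "\<And>i j. i \<in> I \<Longrightarrow> j \<in> I \<Longrightarrow> v i \<bullet> v j = (if i = j then 1 else 0)"
  shows "v j \<bullet> (\<Sum>i\<in>I. c i *\<^sub>R v i) = c j"
proof -
  have "v j \<bullet> (\<Sum>i\<in>I. c i *\<^sub>R v i) = (\<Sum>i\<in>I. if j = i then c i else 0)"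
    unfolding inner_sum_right using assms by (intro sum.cong) auto
  then show ?thesis using assms by simp
qed

lemma Bessel_inequality:
  fixes v :: "'i \<Rightarrow> 'a::real_inner"
  assumes fin: "finite I"
    and orth: "\<And>i j. i \<in> I \<Longrightarrow> j \<in> I \<Longrightarrow> v i \<bullet> v j = (if i = j then 1 else 0)"
  shows "(\<Sum>i\<in>I. (v i \<bullet> x)\<^sup>2) \<le> (norm x)\<^sup>2"
proof -
  define p where "p = (\<Sum>i\<in>I. (v i \<bullet> x) *\<^sub>R v i)"
  have px: "p \<bullet> x = (\<Sum>i\<in>I. (v i \<bullet> x)\<^sup>2)"
    unfolding p_def by (simp add: inner_sum_left power2_eq_square)
  have "v j \<bullet> p = v j \<bullet> x" if "j \<in> I" for j
    unfolding p_def using fin that orth by (rule orthonormal_inner_sum)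
  then have pp: "p \<bullet> p = (\<Sum>i\<in>I. (v i \<bullet> x)\<^sup>2)"
    by (subst (1) p_def) (simp add: inner_sum_left power2_eq_square)
  have "0 \<le> (x - p) \<bullet> (x - p)"
    by simp
  also have "\<dots> = (norm x)\<^sup>2 - p \<bullet> x"
    using px pp by (simp add: inner_diff_left inner_diff_right inner_commute power2_norm_eq_inner)
  finally show ?thesis
    using px by simp
qed

lemma orthonormal_norm_sum:
  fixes v :: "'i \<Rightarrow> 'a::real_inner"
  assumes fin: "finite I"
    and orth: "\<And>i j. i \<in> I \<Longrightarrow> j \<in> I \<Longrightarrow> v i \<bullet> v j = (if i = j then 1 else 0)"
  shows "(norm (\<Sum>i\<in>I. c i *\<^sub>R v i))\<^sup>2 = (\<Sum>i\<in>I. (c i)\<^sup>2)"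
proof -
  have "(norm (\<Sum>i\<in>I. c i *\<^sub>R v i))\<^sup>2
      = (\<Sum>j\<in>I. c j * (v j \<bullet> (\<Sum>i\<in>I. c i *\<^sub>R v i)))"
    unfolding power2_norm_eq_inner by (subst inner_sum_left) simp
  also have "\<dots> = (\<Sum>j\<in>I. (c j)\<^sup>2)"
    by (intro sum.cong refl, subst orthonormal_inner_sum)
      (use fin in \<open>simp_all add: orth power2_eq_square\<close>)
  finally show ?thesis .
qed

lemma orthonormal_independent:
  fixes v :: "'i \<Rightarrow> 'a::euclidean_space"
  assumes fin: "finite I"
    and orth: "\<And>i j. i \<in> I \<Longrightarrow> j \<in> I \<Longrightarrow> v i \<bullet> v j = (if i = j then 1 else 0)"
  shows "inj_on v I" "independent (v ` I)" "dim (v ` I) = card I"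
proof -
  show inj: "inj_on v I"
    by (rule inj_onI) (metis orth zero_neq_one)
  show "independent (v ` I)"
    by (rule pairwise_orthogonal_independent)
      (use orth in \<open>force simp: pairwise_def orthogonal_def\<close>)+
  then show "dim (v ` I) = card I"
    by (simp add: dim_eq_card_independent card_image[OF inj])
qed

text \<open>Fewer than \<open>dim S\<close> linear equations leave a nonzero solution in \<open>S\<close>. This dimension count is
  what drives the Courant-Fischer argument below.\<close>
lemma subspace_orthogonal_complement_nontrivial:
  fixes S :: "'a::euclidean_space set"
  assumes S: "subspace S" and A: "finite A" "card A < dim S"
  obtains x where "x \<in> S" "x \<noteq> 0" "\<And>a. a \<in> A \<Longrightarrow> a \<bullet> x = 0"
proof -
  define P where "P = {y. \<forall>a\<in>span A. orthogonal a y}"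
  have P: "subspace P"
    unfolding P_def by (auto simp: subspace_def orthogonal_clauses)
  have "dim {y \<in> UNIV. \<forall>a\<in>span A. orthogonal a y} + dim (span A) = dim (UNIV :: 'a set)"
    by (rule dim_subspace_orthogonal_to_vectors) auto
  moreover have "dim (span A) \<le> card A"
    by (simp add: A(1) dim_le_card')
  ultimately have dP: "DIM('a) \<le> dim P + card A"
    by (simp add: P_def)
  have "dim {x + y |x y. x \<in> S \<and> y \<in> P} \<le> DIM('a)"
    by (rule dim_subset_UNIV)
  then have "dim (S \<inter> P) > 0"
    using dim_sums_Int[OF S P] dP A(2) by linarith
  then obtain x where "x \<in> S \<inter> P" "x \<noteq> 0"
    by (metis dim_eq_0 less_numeral_extra(3) subsetI singletonI)
  then show thesis
    using that by (auto simp: P_def orthogonal_def span_base)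
qed

text \<open>The projection is the point of the subspace closest to \<open>z\<close>. It therefore suffices to exhibit
  one good approximation \<open>p\<close> in order to bound the residual.\<close>
lemma orthogonal_projection_residual_le:
  fixes S :: "'a::euclidean_space set"
  assumes S: "subspace S" and p: "p \<in> S"
  shows "norm (z - orthogonal_projection S z) \<le> norm (z - p)"
proof -
  obtain y w where "y \<in> span S" and w: "\<And>v. v \<in> span S \<Longrightarrow> orthogonal w v" and z: "z = y + w"
    using orthogonal_subspace_decomp_exists by blast
  have ex: "y \<in> S \<and> (\<forall>v\<in>S. orthogonal (z - y) v)"
    using \<open>y \<in> span S\<close> w z S by (simp add: span_base) (metis span_eq_iff)
  have "orthogonal_projection S z = y"
    unfolding orthogonal_projection_def
  proof (rule the_equality, rule ex)
    fix q assume q: "q \<in> S \<and> (\<forall>v\<in>S. orthogonal (z - q) v)"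
    have "q - y \<in> S"
      using ex q S by (simp add: subspace_diff)
    then have "(z - y) \<bullet> (q - y) = 0" "(z - q) \<bullet> (q - y) = 0"
      using ex q by (auto simp: orthogonal_def)
    then have "(q - y) \<bullet> (q - y) = 0"
      by (simp add: inner_diff_left)
    then show "q = y" by simp
  qed
  moreover have "orthogonal (z - y) (y - p)"
    using ex p S by (simp add: subspace_diff)
  then have "(norm ((z - y) + (y - p)))\<^sup>2 = (norm (z - y))\<^sup>2 + (norm (y - p))\<^sup>2"
    by (rule norm_add_Pythagorean)
  then have "norm (z - y) \<le> norm (z - p)"
    by - (rule power2_le_imp_le, auto)
  ultimately show ?thesis by simp
qed

section \<open>Singular values\<close>
context
  fixes f :: "'a::euclidean_space \<Rightarrow> 'b::euclidean_space" and u \<sigma> v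
  assumes svd: "is_svd f u \<sigma> v"
begin

lemma svd_orthonormal:
  "i \<in> {1..min (DIM('a)) (DIM('b))} \<Longrightarrow> j \<in> {1..min (DIM('a)) (DIM('b))} \<Longrightarrow> u i \<bullet> u j = (if i = j then 1 else 0)"
  "i \<in> {1..min (DIM('a)) (DIM('b))} \<Longrightarrow> j \<in> {1..min (DIM('a)) (DIM('b))} \<Longrightarrow> v i \<bullet> v j = (if i = j then 1 else 0)"
  using svd unfolding is_svd_def Let_def by blast+

lemma svd_nonneg: "i \<in> {1..min (DIM('a)) (DIM('b))} \<Longrightarrow> 0 \<le> \<sigma> i"
  using svd unfolding is_svd_def Let_def by blast

lemma svd_antimono: "i \<in> {1..min (DIM('a)) (DIM('b))} \<Longrightarrow> j \<in> {1..min (DIM('a)) (DIM('b))} \<Longrightarrow> i \<le> j \<Longrightarrow> \<sigma> j \<le> \<sigma> i"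
  using svd unfolding is_svd_def Let_def by blast

lemma svd_expand: "f x = (\<Sum>i\<in>{1..min (DIM('a)) (DIM('b))}. (\<sigma> i * (v i \<bullet> x)) *\<^sub>R u i)"
  using svd unfolding is_svd_def Let_def by blast

lemma svd_right_vector: "j \<in> {1..min (DIM('a)) (DIM('b))} \<Longrightarrow> f (v j) = \<sigma> j *\<^sub>R u j"
  unfolding svd_expand
  by (simp add: svd_orthonormal if_distrib if_distribR cong: if_cong del: atLeastAtMost_iff)

lemma svd_norm_sq: "(norm (f x))\<^sup>2 = (\<Sum>i\<in>{1..min (DIM('a)) (DIM('b))}. (\<sigma> i)\<^sup>2 * (v i \<bullet> x)\<^sup>2)"
  unfolding svd_expand
  by (subst orthonormal_norm_sum) (simp_all add: svd_orthonormal power_mult_distrib del: atLeastAtMost_iff)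

text \<open>The two halves of the Courant-Fischer principle: \<open>f\<close> stretches by at most \<open>\<sigma> k\<close> on the orthogonal
  complement of the first \<open>k - 1\<close> right singular vectors, and by at least \<open>\<sigma> k\<close> on the span of the
  first \<open>k\<close> of them.\<close>
lemma svd_norm_le:
  assumes k: "k \<in> {1..min (DIM('a)) (DIM('b))}" and x: "\<And>i. i \<in> {1..min (DIM('a)) (DIM('b))} \<Longrightarrow> i < k \<Longrightarrow> v i \<bullet> x = 0"
  shows "norm (f x) \<le> \<sigma> k * norm x"
proof -
  have "(norm (f x))\<^sup>2 \<le> (\<Sum>i\<in>{1..min (DIM('a)) (DIM('b))}. (\<sigma> k)\<^sup>2 * (v i \<bullet> x)\<^sup>2)"
    unfolding svd_norm_sq
  proof (rule sum_mono)
    fix i assume i: "i \<in> {1..min (DIM('a)) (DIM('b))}"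
    show "(\<sigma> i)\<^sup>2 * (v i \<bullet> x)\<^sup>2 \<le> (\<sigma> k)\<^sup>2 * (v i \<bullet> x)\<^sup>2"
      using x[OF i] svd_antimono[OF k i] svd_nonneg[OF i]
      by (cases "i < k") (auto intro!: mult_right_mono power_mono)
  qed
  also have "\<dots> \<le> (\<sigma> k)\<^sup>2 * (norm x)\<^sup>2"
    unfolding sum_distrib_left[symmetric]
    by (intro mult_left_mono Bessel_inequality) (simp_all add: svd_orthonormal del: atLeastAtMost_iff)
  finally show ?thesis
    by - (rule power2_le_imp_le, auto simp: power_mult_distrib svd_nonneg[OF k])
qed

lemma svd_norm_ge:
  assumes k: "k \<in> {1..min (DIM('a)) (DIM('b))}" and x: "x \<in> span (v ` {1..k})"
  shows "\<sigma> k * norm x \<le> norm (f x)"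
proof -
  have sub: "{1..k} \<subseteq> {1..min (DIM('a)) (DIM('b))}" using k by auto
  have on: "v i \<bullet> v j = (if i = j then 1 else 0)" if "i \<in> {1..k}" "j \<in> {1..k}" for i j
    using that sub by (intro svd_orthonormal) auto
  have "span (v ` {1..k}) = range (\<lambda>c. \<Sum>w\<in>v ` {1..k}. c w *\<^sub>R w)"
    by (rule span_finite) simp
  then obtain c where "x = (\<Sum>w\<in>v ` {1..k}. c w *\<^sub>R w)"
    using x by auto
  also have "\<dots> = (\<Sum>i\<in>{1..k}. c (v i) *\<^sub>R v i)"
    by (rule sum.reindex_cong[OF orthonormal_independent(1)]) (use on in auto)
  finally have xc: "x = (\<Sum>i\<in>{1..k}. c (v i) *\<^sub>R v i)" .
  have vx: "v i \<bullet> x = c (v i)" if "i \<in> {1..k}" for i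
    unfolding xc using that on by (intro orthonormal_inner_sum) auto
  have "(\<sigma> k)\<^sup>2 * (norm x)\<^sup>2 = (\<Sum>i\<in>{1..k}. (\<sigma> k)\<^sup>2 * (c (v i))\<^sup>2)"
    unfolding xc by (subst orthonormal_norm_sum) (use on in \<open>auto simp: sum_distrib_left\<close>)
  also have "\<dots> \<le> (\<Sum>i\<in>{1..k}. (\<sigma> i)\<^sup>2 * (v i \<bullet> x)\<^sup>2)"
  proof (rule sum_mono)
    fix i assume i: "i \<in> {1..k}"
    then have "\<sigma> k \<le> \<sigma> i" using sub k by (intro svd_antimono) auto
    then show "(\<sigma> k)\<^sup>2 * (c (v i))\<^sup>2 \<le> (\<sigma> i)\<^sup>2 * (v i \<bullet> x)\<^sup>2"
      using vx[OF i] svd_nonneg[OF k] by (auto intro!: mult_right_mono power_mono)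
  qed
  also have "\<dots> \<le> (norm (f x))\<^sup>2"
    unfolding svd_norm_sq by (rule sum_mono2) (use sub in auto)
  finally show ?thesis
    by - (rule power2_le_imp_le, auto simp: power_mult_distrib)
qed

text \<open>A \<open>k\<close>-dimensional subspace meets the orthogonal complement of the first \<open>k - 1\<close> right singular
  vectors, and a vector in the intersection is stretched by at most \<open>\<sigma> k\<close>.\<close>
lemma svd_ge_if_expanding:
  assumes k: "k \<in> {1..min (DIM('a)) (DIM('b))}" and S: "subspace S" "k \<le> dim S"
    and m: "\<And>x. x \<in> S \<Longrightarrow> m * norm x \<le> norm (f x)"
  shows "m \<le> \<sigma> k"
proof -
  have "card (v ` {1..<k}) \<le> card {1..<k}"
    by (rule card_image_le) simp
  then have "card (v ` {1..<k}) < dim S"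
    using S(2) k by auto
  then obtain x where x: "x \<in> S" "x \<noteq> 0" "\<And>a. a \<in> v ` {1..<k} \<Longrightarrow> a \<bullet> x = 0"
    by (rule subspace_orthogonal_complement_nontrivial[OF S(1) finite_imageI[OF finite_atLeastLessThan]])
      blast
  have "m * norm x \<le> \<sigma> k * norm x"
    by (rule order_trans[OF m[OF x(1)] svd_norm_le[OF k]]) (use x(3) in auto)
  then show ?thesis using x(2) by simp
qed

text \<open>The left vectors with positive singular value lie in the range, and \<open>k\<close> of them already exhaust a
  range of dimension at most \<open>k\<close>.\<close>
lemma range_subset_span_left_vectors:
  assumes k: "k \<in> {1..min (DIM('a)) (DIM('b))}" and f: "linear f" and pos: "0 < \<sigma> k" and dim: "dim (range f) \<le> k"
  shows "range f \<subseteq> span (u ` {1..k})"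
proof -
  have sub: "{1..k} \<subseteq> {1..min (DIM('a)) (DIM('b))}" using k by auto
  have "u i \<in> range f" if "i \<in> {1..k}" for i
  proof -
    have "0 < \<sigma> i"
      using svd_antimono[of i k] that sub k pos by force
    then have "u i = f ((1 / \<sigma> i) *\<^sub>R v i)"
      using svd_right_vector[of i] that sub by (auto simp: linear_scale[OF f])
    then show ?thesis by blast
  qed
  then have "span (u ` {1..k}) \<subseteq> range f"
    by (intro span_minimal) (auto simp: f linear_subspace_image)
  moreover have "dim (span (u ` {1..k})) = k"
    unfolding dim_span by (subst orthonormal_independent(3)) (use sub in \<open>auto simp: svd_orthonormal\<close>)
  ultimately have "span (u ` {1..k}) = range f"
    by (intro subspace_dim_equal) (use dim in \<open>auto simp: f linear_subspace_image\<close>)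
  then show ?thesis by simp
qed

end

text \<open>On the span of the first \<open>k\<close> right singular vectors of \<open>f\<close>, the nearby map \<open>g\<close> still stretches by
  \<open>\<sigma> k - e\<close>.\<close>
lemma svd_Weyl:
  fixes f g :: "'a::euclidean_space \<Rightarrow> 'b::euclidean_space"
  assumes f: "is_svd f u \<sigma> v" and g: "is_svd g u' \<sigma>' v'"
    and k: "k \<in> {1..min (DIM('a)) (DIM('b))}"
    and close: "\<And>x. norm (f x - g x) \<le> e * norm x"
  shows "\<sigma> k - e \<le> \<sigma>' k"
proof (rule svd_ge_if_expanding[OF g k])
  have "dim (v ` {1..k}) = k"
    by (subst orthonormal_independent(3)) (use k in \<open>auto simp: svd_orthonormal(2)[OF f]\<close>)
  then show "k \<le> dim (span (v ` {1..k}))" by simp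
  fix x assume "x \<in> span (v ` {1..k})"
  then have "\<sigma> k * norm x \<le> norm (f x)"
    by (rule svd_norm_ge[OF f k])
  also have "\<dots> \<le> norm (f x - g x) + norm (g x)"
    by norm
  also have "\<dots> \<le> e * norm x + norm (g x)"
    using close by simp
  finally show "(\<sigma> k - e) * norm x \<le> norm (g x)"
    by (simp add: left_diff_distrib)
qed simp

text \<open>Weyl's inequality with \<open>e = 0\<close>, applied in both directions, shows that all singular value
  decompositions of \<open>f\<close> have the same singular values.\<close>
lemma singular_value_eq:
  fixes f :: "'a::euclidean_space \<Rightarrow> 'b::euclidean_space"
  assumes f: "is_svd f u \<sigma> v" and k: "k \<in> {1..min (DIM('a)) (DIM('b))}"
  shows "singular_value k f = \<sigma> k"
  unfolding singular_value_def
proof (rule the_equality)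
  show "\<exists>u' \<sigma>' v'. is_svd f u' \<sigma>' v' \<and> \<sigma> k = \<sigma>' k" using f by blast
  fix t assume "\<exists>u' \<sigma>' v'. is_svd f u' \<sigma>' v' \<and> t = \<sigma>' k"
  then obtain u' \<sigma>' v' where g: "is_svd f u' \<sigma>' v'" "t = \<sigma>' k" by blast
  show "t = \<sigma> k"
    using svd_Weyl[OF f g(1) k, of 0] svd_Weyl[OF g(1) f k, of 0] g(2) by simp
qed

section \<open>The factorization map and its derivative\<close>
lemma F_asym_nth:
  "F_asym (W, X, Y) $ i $ j $ k = (\<Sum>l\<in>UNIV. W $ i $ l * X $ j $ l * Y $ k $ l)"
  by (simp add: F_asym_def outer3_def column_def)

text \<open>Trilinearity: every estimate and derivative of the map comes from expanding in the three slots.\<close>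
lemma F_asym_linear:
  "F_asym (A + A', B, C) = F_asym (A, B, C) + F_asym (A', B, C)"
  "F_asym (A, B + B', C) = F_asym (A, B, C) + F_asym (A, B', C)"
  "F_asym (A, B, C + C') = F_asym (A, B, C) + F_asym (A, B, C')"
  "F_asym (A - A', B, C) = F_asym (A, B, C) - F_asym (A', B, C)"
  "F_asym (A, B - B', C) = F_asym (A, B, C) - F_asym (A, B', C)"
  "F_asym (A, B, C - C') = F_asym (A, B, C) - F_asym (A, B, C')"
  "F_asym (c *\<^sub>R A, B, C) = c *\<^sub>R F_asym (A, B, C)"
  "F_asym (A, c *\<^sub>R B, C) = c *\<^sub>R F_asym (A, B, C)"
  "F_asym (A, B, c *\<^sub>R C) = c *\<^sub>R F_asym (A, B, C)"
  by (simp_all add: vec_eq_iff F_asym_nth algebra_simps sum.distrib sum_subtractf sum_distrib_left)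

text \<open>By Cauchy-Schwarz each entry is at most the product of the norms of the three rows that meet in it,
  and the tensor of these products has norm \<open>norm A * norm B * norm C\<close>.\<close>
lemma norm_F_asym_le: "norm (F_asym (A, B, C)) \<le> norm A * norm B * norm C"
proof -
  have entry: "\<bar>F_asym (A, B, C) $ i $ j $ k\<bar> \<le> norm (A $ i) * norm (B $ j) * norm (C $ k)" for i j k
  proof -
    have "\<bar>F_asym (A, B, C) $ i $ j $ k\<bar> \<le> (\<Sum>l\<in>UNIV. \<bar>A $ i $ l * B $ j $ l * C $ k $ l\<bar>)"
      unfolding F_asym_nth by (rule sum_abs)
    also have "\<dots> \<le> (\<Sum>l\<in>UNIV. \<bar>A $ i $ l\<bar> * \<bar>B $ j $ l\<bar> * norm (C $ k))"
      unfolding abs_mult by (intro sum_mono mult_left_mono component_le_norm_cart) auto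
    also have "\<dots> \<le> norm (A $ i) * norm (B $ j) * norm (C $ k)"
      unfolding sum_distrib_right[symmetric] norm_vec_def[of "A $ i"] norm_vec_def[of "B $ j"]
      using L2_set_mult_ineq[of "\<lambda>l. norm (A $ i $ l)" "\<lambda>l. norm (B $ j $ l)" UNIV]
      by (intro mult_right_mono) auto
    finally show ?thesis .
  qed
  have "norm (F_asym (A, B, C)) = L2_set (\<lambda>i. L2_set (\<lambda>j. L2_set
      (\<lambda>k. \<bar>F_asym (A, B, C) $ i $ j $ k\<bar>) UNIV) UNIV) UNIV"
    by (simp add: norm_vec_def)
  also have "\<dots> \<le> L2_set (\<lambda>i. L2_set (\<lambda>j. L2_set
      (\<lambda>k. norm (A $ i) * norm (B $ j) * norm (C $ k)) UNIV) UNIV) UNIV"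
    by (intro L2_set_mono entry) auto
  also have "\<dots> = norm A * norm B * norm C"
    by (simp add: L2_set_right_distrib[symmetric] L2_set_left_distrib[symmetric]
        norm_vec_def[of A] norm_vec_def[of B] norm_vec_def[of C])
  finally show ?thesis .
qed

lemma norm_F_asym_le_mult:
  assumes "norm A \<le> a" "norm B \<le> b" "norm C \<le> c"
  shows "norm (F_asym (A, B, C)) \<le> a * b * c"
proof -
  have "0 \<le> a" "0 \<le> b"
    using assms(1,2) norm_ge_zero order_trans by blast+
  then have "norm A * norm B * norm C \<le> a * b * c"
    by (intro mult_mono assms) auto
  then show ?thesis
    using norm_F_asym_le order_trans by blast
qed

definition F_asym_deriv ::
  "(real^'r^'d1) \<times> (real^'r^'d2) \<times> (real^'r^'d3) \<Rightarrow> (real^'r^'d1) \<times> (real^'r^'d2) \<times> (real^'r^'d3)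
    \<Rightarrow> real^'d3^'d2^'d1"
where
  "F_asym_deriv = (\<lambda>(W, X, Y) (A, B, C). F_asym (A, X, Y) + F_asym (W, B, Y) + F_asym (W, X, C))"

lemma linear_F_asym_deriv: "linear (F_asym_deriv p)"
  by (rule linearI; cases p)
    (auto simp: F_asym_deriv_def F_asym_linear algebra_simps split: prod.splits)

lemma norm_triple_bounds:
  "norm A \<le> norm (A, B, C)" "norm B \<le> norm (A, B, C)" "norm C \<le> norm (A, B, C)"
  using norm_fst_le[of A "(B, C)"] norm_snd_le[of "(B, C)" A] norm_fst_le[of B C] norm_snd_le[of C B]
  by linarith+

text \<open>Of the eight terms in the expansion of \<open>F_asym (p + h)\<close>, the three with two slots from \<open>h\<close> and the
  one with three slots from \<open>h\<close> remain.\<close>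
lemma F_asym_Taylor:
  "norm (F_asym (p + h) - F_asym p - F_asym_deriv p h) \<le> (3 * norm p + norm h) * (norm h)\<^sup>2"
proof -
  obtain W X Y where p: "p = (W, X, Y)" by (cases p)
  obtain A B C where h: "h = (A, B, C)" by (cases h)
  note pn = norm_triple_bounds[where A = W and B = X and C = Y, folded p] and hn = norm_triple_bounds[where A = A and B = B and C = C, folded h]
  have "F_asym (p + h) - F_asym p - F_asym_deriv p h
      = F_asym (A, B, Y) + F_asym (A, X, C) + F_asym (W, B, C) + F_asym (A, B, C)"
    unfolding p h by (simp add: F_asym_deriv_def F_asym_linear)
  also have "norm \<dots> \<le> norm (F_asym (A, B, Y)) + norm (F_asym (A, X, C)) + norm (F_asym (W, B, C))
      + norm (F_asym (A, B, C))"
    by norm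
  also have "\<dots> \<le> norm h * norm h * norm p + norm h * norm p * norm h + norm p * norm h * norm h
      + norm h * norm h * norm h"
    by (intro add_mono norm_F_asym_le_mult pn hn)
  finally show ?thesis
    by (simp add: algebra_simps power2_eq_square)
qed

lemma F_asym_has_derivative: "(F_asym has_derivative F_asym_deriv p) (at p)"
proof (rule has_derivativeI_sandwich[of 1])
  show "bounded_linear (F_asym_deriv p)"
    using linear_F_asym_deriv by (simp add: linear_conv_bounded_linear)
  fix q assume q: "q \<noteq> p" "dist q p < 1"
  have "norm (F_asym q - F_asym p - F_asym_deriv p (q - p)) \<le> (3 * norm p + norm (q - p)) * (norm (q - p))\<^sup>2"
    using F_asym_Taylor[of p "q - p"] by simp
  also have "\<dots> \<le> (3 * norm p + 1) * (norm (q - p))\<^sup>2"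
    using q by (intro mult_right_mono) (auto simp: dist_norm)
  finally show "norm (F_asym q - F_asym p - F_asym_deriv p (q - p)) / norm (q - p)
      \<le> (3 * norm p + 1) * norm (q - p)"
    using q by (simp add: field_simps power2_eq_square)
next
  have "((\<lambda>q. (3 * norm p + 1) * norm (q - p)) \<longlongrightarrow> (3 * norm p + 1) * norm (p - p)) (at p)"
    by (intro tendsto_intros)
  then show "((\<lambda>q. (3 * norm p + 1) * norm (q - p)) \<longlongrightarrow> 0) (at p)" by simp
qed simp

lemma deriv_at_F_asym: "deriv_at F_asym p = F_asym_deriv p"
  by (rule frechet_derivative_at[OF F_asym_has_derivative, symmetric])

lemma continuously_differentiable_F_asym: "continuously_differentiable F_asym"
  unfolding continuously_differentiable_def
proof (intro exI conjI allI)
  have bl: "blinfun_apply (Blinfun (F_asym_deriv p)) = F_asym_deriv p" for p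
    by (rule bounded_linear_Blinfun_apply) (use linear_F_asym_deriv linear_conv_bounded_linear in blast)
  show "(F_asym has_derivative blinfun_apply (Blinfun (F_asym_deriv p))) (at p)" for p
    unfolding bl by (rule F_asym_has_derivative)
  have cont: "continuous_on UNIV F_asym"
    by (meson F_asym_has_derivative has_derivative_continuous_on has_derivative_at_withinI)
  show "continuous_on UNIV (\<lambda>p. Blinfun (F_asym_deriv p))"
  proof (rule continuous_on_blinfun_componentwise)
    fix h
    show "continuous_on UNIV (\<lambda>p. blinfun_apply (Blinfun (F_asym_deriv p)) h)"
      unfolding bl unfolding F_asym_deriv_def case_prod_unfold
      by (intro continuous_intros continuous_on_compose2[OF cont]) auto
  qed
qed

text \<open>Changing one factor at a time splits the difference into six terms. Each of the three components of
  \<open>h\<close> occurs in two of them, and the sum of their three norms is at most \<open>sqrt 3 * norm h\<close>.\<close>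
lemma F_asym_deriv_Lipschitz:
  assumes p: "norm p \<le> M" and q: "norm q \<le> M"
  shows "norm (F_asym_deriv p h - F_asym_deriv q h) \<le> 2 * sqrt 3 * M * norm (p - q) * norm h"
proof -
  obtain W X Y where p': "p = (W, X, Y)" by (cases p)
  obtain W' X' Y' where q': "q = (W', X', Y')" by (cases q)
  obtain A B C where h: "h = (A, B, C)" by (cases h)
  let ?d = "norm (p - q)"
  have M: "0 \<le> M" using p norm_ge_zero order_trans by blast
  have pn: "norm X \<le> M" "norm Y \<le> M" and qn: "norm W' \<le> M" "norm X' \<le> M"
    using norm_triple_bounds[where A = W and B = X and C = Y] norm_triple_bounds[where A = W' and B = X' and C = Y'] p q unfolding p' q' by linarith+
  have dn: "norm (W - W') \<le> ?d" "norm (X - X') \<le> ?d" "norm (Y - Y') \<le> ?d"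
    using norm_triple_bounds[where A = "W - W'" and B = "X - X'" and C = "Y - Y'"] unfolding p' q' by simp_all
  have "F_asym_deriv p h - F_asym_deriv q h
      = F_asym (A, X - X', Y) + F_asym (A, X', Y - Y')
      + F_asym (W - W', B, Y) + F_asym (W', B, Y - Y')
      + F_asym (W - W', X, C) + F_asym (W', X - X', C)"
    unfolding p' q' h by (simp add: F_asym_deriv_def F_asym_linear)
  also have "norm \<dots> \<le> norm (F_asym (A, X - X', Y)) + norm (F_asym (A, X', Y - Y'))
      + norm (F_asym (W - W', B, Y)) + norm (F_asym (W', B, Y - Y'))
      + norm (F_asym (W - W', X, C)) + norm (F_asym (W', X - X', C))"
    by norm
  also have "\<dots> \<le> norm A * ?d * M + norm A * M * ?d + ?d * norm B * M + M * norm B * ?d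
      + ?d * M * norm C + M * ?d * norm C"
    by (intro add_mono norm_F_asym_le_mult pn qn dn order_refl)
  also have "\<dots> = 2 * M * ?d * (norm A + norm B + norm C)"
    by (simp add: algebra_simps)
  also have "\<dots> \<le> 2 * M * ?d * (sqrt 3 * norm h)"
  proof (intro mult_left_mono)
    have "0 \<le> (norm A - norm B)\<^sup>2 + (norm B - norm C)\<^sup>2 + (norm A - norm C)\<^sup>2"
      by simp
    then have "(norm A + norm B + norm C)\<^sup>2 \<le> (sqrt 3 * norm h)\<^sup>2"
      unfolding h norm_Pair power_mult_distrib by (simp add: algebra_simps power2_eq_square)
    then show "norm A + norm B + norm C \<le> sqrt 3 * norm h"
      by (rule power2_le_imp_le) simp
  qed (use M in auto)
  finally show ?thesis
    by (simp add: algebra_simps)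
qed

section \<open>A slice transversal to the rescaling symmetry\<close>

text \<open>The product \<open>W\<^sub>l \<otimes> X\<^sub>l \<otimes> Y\<^sub>l\<close> is unchanged when its factors are multiplied by scalars with
  product 1. Over all columns this group has dimension \<open>2r\<close>, and the slice has codimension \<open>2r\<close>: its directions do not
  rescale the columns of \<open>W\<close> and \<open>X\<close>, which leaves the columns of \<open>Y\<close> free to move.\<close>
definition gauge_slice ::
  "real^'r^'d1 \<Rightarrow> real^'r^'d2 \<Rightarrow> ((real^'r^'d1) \<times> (real^'r^'d2) \<times> (real^'r^'d3)) set"
where
  "gauge_slice W X = {(A, B, C). \<forall>l. column l W \<bullet> column l A = 0 \<and> column l X \<bullet> column l B = 0}"

lemma subspace_gauge_slice: "subspace (gauge_slice W X)"
  by (auto simp: gauge_slice_def subspace_def zero_prod_def column_def inner_vec_def algebra_simps sum.distrib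
      simp flip: sum_distrib_left)

lemma dim_orthogonal_family_complement:
  fixes g :: "'i::finite \<Rightarrow> 'a::euclidean_space"
  assumes nz: "\<And>i. g i \<noteq> 0" and orth: "\<And>i j. i \<noteq> j \<Longrightarrow> g i \<bullet> g j = 0"
  shows "dim {h. \<forall>i. g i \<bullet> h = 0} + CARD('i) = DIM('a)"
proof -
  have "inj g"
    by (rule injI) (metis nz orth inner_eq_zero_iff)
  moreover have "independent (range g)"
    by (rule pairwise_orthogonal_independent)
      (use nz orth in \<open>auto simp: pairwise_def orthogonal_def, metis\<close>)
  ultimately have "dim (span (range g)) = CARD('i)"
    by (simp add: dim_eq_card_independent card_image)
  moreover have "dim {y \<in> UNIV. \<forall>x\<in>span (range g). orthogonal x y} + dim (span (range g))
      = dim (UNIV :: 'a set)"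
    by (rule dim_subspace_orthogonal_to_vectors) auto
  moreover have "{y \<in> UNIV. \<forall>x\<in>span (range g). orthogonal x y} = {h. \<forall>i. g i \<bullet> h = 0}"
    by (auto simp: orthogonal_def span_base)
      (metis (no_types, lifting) orthogonal_def orthogonal_commute orthogonal_to_span rangeE)
  ultimately show ?thesis by simp
qed

definition only_column :: "'r \<Rightarrow> real^'r^'d \<Rightarrow> real^'r^'d" where
  "only_column l W = (\<chi> i m. if m = l then W $ i $ m else 0)"

lemma inner_only_column: "only_column l W \<bullet> A = column l W \<bullet> column l A"
  by (simp add: only_column_def inner_vec_def column_def if_distrib if_distribR cong: if_cong)

lemma column_only_column: "column m (only_column l W) = (if m = l then column l W else 0)"
  by (simp add: only_column_def column_def vec_eq_iff)

text \<open>The \<open>2r\<close> conditions that cut out the slice are orthogonal to each other, since they involve different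
  columns.\<close>
lemma dim_gauge_slice:
  fixes W :: "real^'r^'d1" and X :: "real^'r^'d2"
  assumes nz: "\<And>l. column l W \<noteq> 0" "\<And>l. column l X \<noteq> 0"
  shows "dim (gauge_slice W X :: ((real^'r^'d1) \<times> (real^'r^'d2) \<times> (real^'r^'d3)) set)
    = (CARD('d1) + CARD('d2) + CARD('d3) - 2) * CARD('r)"
proof -
  define g :: "'r + 'r \<Rightarrow> (real^'r^'d1) \<times> (real^'r^'d2) \<times> (real^'r^'d3)" where
    "g s = (case s of Inl l \<Rightarrow> (only_column l W, 0, 0) | Inr l \<Rightarrow> (0, only_column l X, 0))" for s
  have "{h. \<forall>s. g s \<bullet> h = 0} = gauge_slice W X"
    by (auto simp: g_def gauge_slice_def inner_only_column split_sum_all)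
  moreover have "dim {h. \<forall>s. g s \<bullet> h = 0} + CARD('r + 'r) 
      = DIM((real^'r^'d1) \<times> (real^'r^'d2) \<times> (real^'r^'d3))"
  proof (rule dim_orthogonal_family_complement)
    show "g s \<noteq> 0" for s
    proof
      assume "g s = 0"
      then have "g s \<bullet> g s = 0" by simp
      then show False
        using nz by (cases s) (auto simp: g_def inner_only_column column_only_column)
    qed
    show "g s \<bullet> g s' = 0" if "s \<noteq> s'" for s s'
      using that by (cases s; cases s') (auto simp: g_def inner_only_column column_only_column)
  qed
  ultimately have "dim (gauge_slice W X :: ((real^'r^'d1) \<times> (real^'r^'d2) \<times> (real^'r^'d3)) set)
      + 2 * CARD('r) = (CARD('d1) + CARD('d2) + CARD('d3)) * CARD('r)"
    by (simp add: algebra_simps card_UNIV_sum)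
  then show ?thesis
    by (simp add: diff_mult_distrib)
qed

lemma sum_contract:
  fixes q :: "'b::finite \<Rightarrow> real" and s :: "'c::finite \<Rightarrow> real" and a :: "'r::finite \<Rightarrow> real"
  shows "(\<Sum>j\<in>UNIV. \<Sum>k\<in>UNIV. q j * s k * (\<Sum>l\<in>UNIV. a l * X j l * Y k l))
    = (\<Sum>l\<in>UNIV. a l * (\<Sum>j\<in>UNIV. q j * X j l) * (\<Sum>k\<in>UNIV. s k * Y k l))"
proof -
  have "(\<Sum>j\<in>UNIV. \<Sum>k\<in>UNIV. q j * s k * (\<Sum>l\<in>UNIV. a l * X j l * Y k l))
    = (\<Sum>j\<in>UNIV. \<Sum>k\<in>UNIV. \<Sum>l\<in>UNIV. a l * (q j * X j l) * (s k * Y k l))"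
    by (simp add: sum_distrib_left mult_ac)
  also have "\<dots> = (\<Sum>j\<in>UNIV. \<Sum>l\<in>UNIV. \<Sum>k\<in>UNIV. a l * (q j * X j l) * (s k * Y k l))"
    by (intro sum.cong refl sum.swap)
  also have "\<dots> = (\<Sum>l\<in>UNIV. \<Sum>j\<in>UNIV. \<Sum>k\<in>UNIV. a l * (q j * X j l) * (s k * Y k l))"
    by (rule sum.swap)
  finally show ?thesis
    by (simp add: sum_distrib_left sum_distrib_right mult_ac)
qed

text \<open>Suppose that the derivative kills \<open>(A, B, C)\<close>, and let \<open>a\<close> and \<open>w\<close> be the \<open>i\<close>-th rows of \<open>A\<close> and
  \<open>W\<close>. Contracting the other two indices with the \<open>m\<close>-th rows of left inverses of \<open>X\<close> and \<open>Y\<close>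
  isolates \<open>a m\<close>. Its ratio to \<open>w m\<close> does not depend on \<open>i\<close>, so that the \<open>m\<close>-th column of \<open>A\<close> is a multiple
  of that of \<open>W\<close>.\<close>
lemma kernel_slice_parallel:
  fixes X B :: "real^'r^'b" and Y C :: "real^'r^'c" and a w :: "'r \<Rightarrow> real"
  assumes Q: "Q ** X = mat 1" and S: "S ** Y = mat 1"
    and zero: "\<And>j k. (\<Sum>l\<in>UNIV. a l * X $ j $ l * Y $ k $ l) + (\<Sum>l\<in>UNIV. w l * B $ j $ l * Y $ k $ l)
      + (\<Sum>l\<in>UNIV. w l * X $ j $ l * C $ k $ l) = 0"
  shows "a m = - ((Q ** B) $ m $ m + (S ** C) $ m $ m) * w m"
proof -
  have QX: "(\<Sum>j\<in>UNIV. Q $ m $ j * X $ j $ l) = (if l = m then 1 else 0)" for l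
    using Q by (auto simp: vec_eq_iff matrix_matrix_mult_def mat_def)
  have SY: "(\<Sum>k\<in>UNIV. S $ m $ k * Y $ k $ l) = (if l = m then 1 else 0)" for l
    using S by (auto simp: vec_eq_iff matrix_matrix_mult_def mat_def)
  have "0 = (\<Sum>j\<in>UNIV. \<Sum>k\<in>UNIV. Q $ m $ j * S $ m $ k * ((\<Sum>l\<in>UNIV. a l * X $ j $ l * Y $ k $ l)
      + (\<Sum>l\<in>UNIV. w l * B $ j $ l * Y $ k $ l) + (\<Sum>l\<in>UNIV. w l * X $ j $ l * C $ k $ l)))"
    by (simp add: zero)
  also have "\<dots> = (\<Sum>l\<in>UNIV. a l * (if l = m then 1 else 0) * (if l = m then 1 else 0))
      + (\<Sum>l\<in>UNIV. w l * (\<Sum>j\<in>UNIV. Q $ m $ j * B $ j $ l) * (if l = m then 1 else 0))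
      + (\<Sum>l\<in>UNIV. w l * (if l = m then 1 else 0) * (\<Sum>k\<in>UNIV. S $ m $ k * C $ k $ l))"
    unfolding distrib_left sum.distrib sum_contract QX SY ..
  also have "\<dots> = a m + w m * (Q ** B) $ m $ m + w m * (S ** C) $ m $ m"
    by (simp add: matrix_matrix_mult_def if_distrib if_distribR cong: if_cong)
  finally show ?thesis
    by (simp add: algebra_simps)
qed

lemma full_rank_left_inverse:
  fixes W :: "real^'r^'d"
  assumes "rank W = CARD('r)"
  obtains P :: "real^'d^'r" where "P ** W = mat 1"
  using assms full_rank_injective matrix_left_invertible_injective by blast

lemma full_rank_column_nonzero:
  fixes W :: "real^'r^'d"
  assumes "rank W = CARD('r)"
  shows "column l W \<noteq> 0"
proof
  assume "column l W = 0"
  obtain P :: "real^'d^'r" where "P ** W = mat 1"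
    using full_rank_left_inverse[OF assms] .
  then have "(\<Sum>i\<in>UNIV. P $ l $ i * W $ i $ l) = 1"
    by (simp add: vec_eq_iff matrix_matrix_mult_def mat_def)
  then show False
    using \<open>column l W = 0\<close> by (simp add: column_def vec_eq_iff)
qed

text \<open>A tangent direction killed by the derivative only rescales columns. In the slice the columns of \<open>W\<close>
  and \<open>X\<close> cannot be rescaled; then the factor by which the columns of \<open>Y\<close> are rescaled vanishes as well.\<close>
lemma F_asym_deriv_inj_on_slice:
  fixes W :: "real^'r^'d1" and X :: "real^'r^'d2" and Y :: "real^'r^'d3"
  assumes rank: "rank W = CARD('r)" "rank X = CARD('r)" "rank Y = CARD('r)"
    and h: "h \<in> gauge_slice W X" and zero: "F_asym_deriv (W, X, Y) h = 0"
  shows "h = 0"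
proof -
  obtain A B C where h': "h = (A, B, C)" by (cases h)
  obtain P where P: "P ** W = mat 1" using full_rank_left_inverse[OF rank(1)] .
  obtain Q where Q: "Q ** X = mat 1" using full_rank_left_inverse[OF rank(2)] .
  obtain S where S: "S ** Y = mat 1" using full_rank_left_inverse[OF rank(3)] .
  have z: "(\<Sum>l\<in>UNIV. A $ i $ l * X $ j $ l * Y $ k $ l) + (\<Sum>l\<in>UNIV. W $ i $ l * B $ j $ l * Y $ k $ l)
      + (\<Sum>l\<in>UNIV. W $ i $ l * X $ j $ l * C $ k $ l) = 0" for i j k
    using zero by (simp add: h' F_asym_deriv_def vec_eq_iff F_asym_nth)
  have zero_if_parallel: "A' = 0" if "\<And>l. column l W' \<noteq> 0" "\<And>l. column l W' \<bullet> column l A' = 0"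
      "\<And>i m. A' $ i $ m = c m * W' $ i $ m" for A' W' :: "real^'r^'d" and c
  proof -
    have "column m A' = c m *\<^sub>R column m W'" for m
      by (simp add: vec_eq_iff column_def that(3))
    then have "c m = 0" for m
      using that(1,2)[of m] by simp
    then show ?thesis
      using that(3) by (simp add: vec_eq_iff)
  qed
  have A: "A = 0"
  proof (rule zero_if_parallel[of W])
    show "A $ i $ m = - ((Q ** B) $ m $ m + (S ** C) $ m $ m) * W $ i $ m" for i m
      by (rule kernel_slice_parallel[OF Q S]) (rule z)
  qed (use h rank(1) in \<open>auto simp: h' gauge_slice_def full_rank_column_nonzero\<close>)
  have B: "B = 0"
  proof (rule zero_if_parallel[of X])
    show "B $ j $ m = - ((P ** A) $ m $ m + (S ** C) $ m $ m) * X $ j $ m" for j m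
      by (rule kernel_slice_parallel[OF P S]) (use z in \<open>simp add: mult_ac add_ac\<close>)
  qed (use h rank(2) in \<open>auto simp: h' gauge_slice_def full_rank_column_nonzero\<close>)
  have "C $ k $ m = - ((P ** A) $ m $ m + (Q ** B) $ m $ m) * Y $ k $ m" for k m
    by (rule kernel_slice_parallel[OF P Q]) (use z in \<open>simp add: mult_ac add_ac\<close>)
  then have "C = 0"
    by (simp add: A B vec_eq_iff)
  then show ?thesis by (simp add: h' A B zero_prod_def)
qed

section \<open>Moving a point into the slice\<close>
definition scale_columns :: "('r \<Rightarrow> real) \<Rightarrow> real^'r^'d \<Rightarrow> real^'r^'d" where
  "scale_columns s W = (\<chi> i l. s l * W $ i $ l)"

lemma column_scale_columns: "column l (scale_columns s W) = s l *\<^sub>R column l W"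
  by (simp add: scale_columns_def column_def vec_eq_iff)

lemma column_diff: "column l (M - M') = column l M - column l M'"
  by (simp add: column_def vec_eq_iff)

lemma scale_columns_one: "scale_columns (\<lambda>l. 1) M = M"
  by (simp add: scale_columns_def)

lemma F_asym_scale_columns:
  "F_asym (scale_columns s W, scale_columns t X, scale_columns r Y)
    = F_asym (scale_columns (\<lambda>l. s l * t l * r l) W, X, Y)"
  by (simp add: vec_eq_iff F_asym_nth scale_columns_def mult_ac)

lemma F_asym_deriv_scale_columns:
  "F_asym_deriv (scale_columns s W, scale_columns t X, scale_columns r Y) (A, B, C)
    = F_asym_deriv (W, X, Y) (scale_columns (\<lambda>l. t l * r l) A,
        scale_columns (\<lambda>l. s l * r l) B, scale_columns (\<lambda>l. s l * t l) C)"
  by (simp add: vec_eq_iff F_asym_deriv_def F_asym_nth scale_columns_def mult_ac)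

text \<open>The factor that gives a column of \<open>W\<close> the same component along the corresponding column of \<open>V\<close> as
  that column itself has.\<close>
definition gauge_factor :: "real^'r^'d \<Rightarrow> real^'r^'d \<Rightarrow> 'r \<Rightarrow> real" where
  "gauge_factor V W l = (column l V \<bullet> column l V) / (column l W \<bullet> column l V)"

text \<open>The representative, up to rescaling, of a factorization whose displacement from a point \<open>(V, U, Z)\<close>
  lies in the slice there. The third factor compensates for the other two, so that \<open>Z\<close> does not enter.\<close>
definition gauge_fix ::
  "real^'r^'d1 \<Rightarrow> real^'r^'d2 \<Rightarrow> (real^'r^'d1) \<times> (real^'r^'d2) \<times> (real^'r^'d3)
    \<Rightarrow> (real^'r^'d1) \<times> (real^'r^'d2) \<times> (real^'r^'d3)"
where
  "gauge_fix V U = (\<lambda>(W, X, Y).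
     (scale_columns (gauge_factor V W) W, scale_columns (gauge_factor U X) X,
      scale_columns (\<lambda>l. 1 / (gauge_factor V W l * gauge_factor U X l)) Y))"

text \<open>The points at which \<open>gauge_fix\<close> is a genuine rescaling; no division by zero occurs there.\<close>
definition gauge_transversal ::
  "real^'r^'d1 \<Rightarrow> real^'r^'d2 \<Rightarrow> (real^'r^'d1) \<times> (real^'r^'d2) \<times> (real^'r^'d3) \<Rightarrow> bool"
where
  "gauge_transversal V U = (\<lambda>(W, X, Y).
     \<forall>l. column l W \<bullet> column l V \<noteq> 0 \<and> column l X \<bullet> column l U \<noteq> 0)"

lemma F_asym_gauge_fix:
  assumes tr: "gauge_transversal V U p"
    and nz: "\<And>l. column l V \<noteq> 0" "\<And>l. column l U \<noteq> 0"
  shows "F_asym (gauge_fix V U p) = F_asym p"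
proof -
  obtain W X Y where p: "p = (W, X, Y)" by (cases p)
  have "gauge_factor V W l \<noteq> 0" "gauge_factor U X l \<noteq> 0" for l
    using tr nz by (auto simp: gauge_transversal_def gauge_factor_def p)
  then show ?thesis
    unfolding p gauge_fix_def prod.case F_asym_scale_columns
    by (simp add: scale_columns_one)
qed

lemma gauge_fix_in_slice:
  assumes tr: "gauge_transversal V U p"
  shows "gauge_fix V U p - (V, U, Z) \<in> gauge_slice V U"
proof -
  obtain W X Y where p: "p = (W, X, Y)" by (cases p)
  show ?thesis
    using tr
    by (auto simp: p gauge_transversal_def gauge_fix_def gauge_slice_def column_diff column_scale_columns
        inner_diff_right gauge_factor_def inner_commute)
qed

text \<open>Rescaling the columns of the base point amounts to rescaling those of the tangent direction.\<close>
lemma range_F_asym_deriv_gauge_fix: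
  "range (F_asym_deriv (gauge_fix V U p)) \<subseteq> range (F_asym_deriv p)"
proof
  obtain W X Y where p: "p = (W, X, Y)" by (cases p)
  fix z assume "z \<in> range (F_asym_deriv (gauge_fix V U p))"
  then obtain A B C where "z = F_asym_deriv (gauge_fix V U p) (A, B, C)"
    by auto
  then show "z \<in> range (F_asym_deriv p)"
    unfolding p gauge_fix_def prod.case F_asym_deriv_scale_columns by simp
qed

text \<open>Infinitesimal rescalings of the base point lie in the kernel of the derivative, and subtracting a
  suitable one moves any direction into the slice. This bounds the rank by the dimension of the slice
  at every point satisfying the transversality condition, which is an open condition.\<close>
lemma range_F_asym_deriv_eq_slice:
  assumes tr: "gauge_transversal V U p"
  shows "range (F_asym_deriv p) = F_asym_deriv p ` gauge_slice V U"
proof (intro equalityI subsetI)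
  obtain W X Y where p: "p = (W, X, Y)" by (cases p)
  fix z assume "z \<in> range (F_asym_deriv p)"
  then obtain A B C where z: "z = F_asym_deriv p (A, B, C)"
    by auto
  define \<alpha> \<beta> where "\<alpha> l = (column l A \<bullet> column l V) / (column l W \<bullet> column l V)"
    and "\<beta> l = (column l B \<bullet> column l U) / (column l X \<bullet> column l U)" for l
  let ?h = "(A - scale_columns \<alpha> W, B - scale_columns \<beta> X, C + scale_columns (\<lambda>l. \<alpha> l + \<beta> l) Y)"
  have "?h \<in> gauge_slice V U"
    using tr
    by (auto simp: p gauge_transversal_def gauge_slice_def column_diff column_scale_columns
        inner_diff_right \<alpha>_def \<beta>_def inner_commute)
  moreover have "F_asym_deriv p ?h = z"
    unfolding z p
    by (simp add: F_asym_deriv_def vec_eq_iff F_asym_nth scale_columns_def algebra_simps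
        sum.distrib sum_subtractf)
  ultimately show "z \<in> F_asym_deriv p ` gauge_slice V U"
    by blast
qed blast

lemma tendsto_column [tendsto_intros]:
  "(f \<longlongrightarrow> W) F \<Longrightarrow> ((\<lambda>x. column l (f x)) \<longlongrightarrow> column l W) F"
  unfolding column_def by (intro tendsto_intros)

lemma tendsto_scale_columns [tendsto_intros]:
  "(\<And>l. ((\<lambda>x. s x l) \<longlongrightarrow> t l) F) \<Longrightarrow> (f \<longlongrightarrow> W) F
    \<Longrightarrow> ((\<lambda>x. scale_columns (s x) (f x)) \<longlongrightarrow> scale_columns t W) F"
  unfolding scale_columns_def by (intro tendsto_intros)

lemma tendsto_gauge_factor:
  assumes "(f \<longlongrightarrow> V) F" "column l V \<noteq> 0"
  shows "((\<lambda>x. gauge_factor V (f x) l) \<longlongrightarrow> 1) F"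
proof -
  have "((\<lambda>x. gauge_factor V (f x) l) \<longlongrightarrow> (column l V \<bullet> column l V) / (column l V \<bullet> column l V)) F"
    unfolding gauge_factor_def using assms by (intro tendsto_intros) auto
  then show ?thesis using assms(2) by simp
qed

lemma gauge_fix_tendsto:
  fixes V :: "real^'r^'d1" and U :: "real^'r^'d2" and Z :: "real^'r^'d3"
  assumes nz: "\<And>l. column l V \<noteq> 0" "\<And>l. column l U \<noteq> 0"
  shows "(gauge_fix V U \<longlongrightarrow> (V, U, Z)) (nhds (V, U, Z))"
proof -
  let ?F = "nhds (V, U, Z)"
  have lim: "(fst \<longlongrightarrow> V) ?F" "((\<lambda>p. fst (snd p)) \<longlongrightarrow> U) ?F" "((\<lambda>p. snd (snd p)) \<longlongrightarrow> Z) ?F"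
    by (auto intro!: tendsto_eq_intros filterlim_ident)
  have "((\<lambda>p. 1 / (gauge_factor V (fst p) l * gauge_factor U (fst (snd p)) l)) \<longlongrightarrow> 1 / (1 * 1)) ?F" for l
    by (intro tendsto_intros tendsto_gauge_factor lim nz) simp
  then have "((\<lambda>p. (scale_columns (gauge_factor V (fst p)) (fst p),
      scale_columns (gauge_factor U (fst (snd p))) (fst (snd p)),
      scale_columns (\<lambda>l. 1 / (gauge_factor V (fst p) l * gauge_factor U (fst (snd p)) l)) (snd (snd p))))
      \<longlongrightarrow> (scale_columns (\<lambda>l. 1) V, scale_columns (\<lambda>l. 1) U, scale_columns (\<lambda>l. 1) Z)) ?F"
    by (intro tendsto_intros tendsto_gauge_factor lim nz) simp
  then show ?thesis
    by (simp add: gauge_fix_def case_prod_unfold scale_columns_one)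
qed

lemma eventually_gauge_transversal:
  fixes V :: "real^'r^'d1" and U :: "real^'r^'d2" and Z :: "real^'r^'d3"
  assumes nz: "\<And>l. column l V \<noteq> 0" "\<And>l. column l U \<noteq> 0"
  shows "\<forall>\<^sub>F p in nhds (V, U, Z). gauge_transversal V U p"
proof -
  let ?F = "nhds (V, U, Z)"
  have lim: "(fst \<longlongrightarrow> V) ?F" "((\<lambda>p. fst (snd p)) \<longlongrightarrow> U) ?F"
    by (auto intro!: tendsto_eq_intros filterlim_ident)
  have "((\<lambda>p. column l (fst p) \<bullet> column l V) \<longlongrightarrow> column l V \<bullet> column l V) ?F" for l
    by (intro tendsto_intros lim)
  then have 1: "\<forall>\<^sub>F p in ?F. column l (fst p) \<bullet> column l V \<noteq> 0" for l
    by (rule tendsto_imp_eventually_ne) (simp add: nz)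
  have "((\<lambda>p. column l (fst (snd p)) \<bullet> column l U) \<longlongrightarrow> column l U \<bullet> column l U) ?F" for l
    by (intro tendsto_intros lim)
  then have 2: "\<forall>\<^sub>F p in ?F. column l (fst (snd p)) \<bullet> column l U \<noteq> 0" for l
    by (rule tendsto_imp_eventually_ne) (simp add: nz)
  show ?thesis
    unfolding gauge_transversal_def case_prod_unfold
    by (intro eventually_all_finite eventually_conj 1 2)
qed

section \<open>Secants of the image near the reference point\<close>
lemma F_asym_deriv_expanding_on_slice:
  fixes W :: "real^'r^'d1" and X :: "real^'r^'d2" and Y :: "real^'r^'d3"
  assumes "rank W = CARD('r)" "rank X = CARD('r)" "rank Y = CARD('r)"
  obtains m where "0 < m" "\<And>h. h \<in> gauge_slice W X \<Longrightarrow> m * norm h \<le> norm (F_asym_deriv (W, X, Y) h)"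
proof -
  have "\<exists>m>0. \<forall>h\<in>gauge_slice W X. m * norm h \<le> norm (F_asym_deriv (W, X, Y) h)"
  proof (rule injective_imp_isometric)
    show "bounded_linear (F_asym_deriv (W, X, Y))"
      using linear_F_asym_deriv linear_conv_bounded_linear by blast
  qed (use F_asym_deriv_inj_on_slice[OF assms] in \<open>auto simp: subspace_gauge_slice closed_subspace\<close>)
  then show thesis using that by blast
qed

text \<open>Replace \<open>p\<close> by its representative \<open>g = x + h\<close> in the slice: the value of the map is the same and the
  tangent space does not grow. The derivative at \<open>x\<close> is bounded below on the slice, so that \<open>norm h\<close> is at
  most a constant times the distance of the values. Hence the Taylor remainder at \<open>g\<close> in the
  direction of \<open>x\<close>, which is quadratic in \<open>norm h\<close>, is quadratic in that distance.\<close>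
lemma F_asym_secant_near_tangent:
  fixes W :: "real^'r^'d1" and X :: "real^'r^'d2" and Y :: "real^'r^'d3"
  assumes rank: "rank W = CARD('r)" "rank X = CARD('r)" "rank Y = CARD('r)"
  defines "x \<equiv> (W, X, Y)"
  obtains R C where "0 < R" "0 < C"
    "\<And>p. p \<in> cball x R \<Longrightarrow>
       dim (range (F_asym_deriv p)) \<le> (CARD('d1) + CARD('d2) + CARD('d3) - 2) * CARD('r)"
    "\<And>p. p \<in> cball x R \<Longrightarrow> \<exists>t\<in>range (F_asym_deriv p).
       norm (F_asym p - F_asym x - t) \<le> C * (norm (F_asym p - F_asym x))\<^sup>2"
proof -
  note nz = full_rank_column_nonzero[OF rank(1)] full_rank_column_nonzero[OF rank(2)]
  obtain m where m: "0 < m"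
    "\<And>h. h \<in> gauge_slice W X \<Longrightarrow> m * norm h \<le> norm (F_asym_deriv x h)"
    unfolding x_def using F_asym_deriv_expanding_on_slice[OF rank] by blast
  define N where "N = norm x"
  \<comment> \<open>Within radius \<open>\<eta>\<close> the Taylor remainder at \<open>x\<close> takes away at most half of the lower bound \<open>m\<close>.\<close>
  define \<eta> where "\<eta> = min 1 (m / (2 * (3 * N + 1)))"
  have N: "0 \<le> N" by (simp add: N_def)
  have \<eta>: "0 < \<eta>" "\<eta> \<le> 1" "(3 * N + 1) * \<eta> \<le> m / 2"
  proof -
    show "0 < \<eta>" "\<eta> \<le> 1" using m N by (auto simp: \<eta>_def)
    have "(3 * N + 1) * \<eta> \<le> (3 * N + 1) * (m / (2 * (3 * N + 1)))"
      using N by (intro mult_left_mono) (auto simp: \<eta>_def)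
    also have "\<dots> = m / 2"
      using N by (simp add: field_simps)
    finally show "(3 * N + 1) * \<eta> \<le> m / 2" .
  qed
  have "\<forall>\<^sub>F p in nhds x. dist (gauge_fix W X p) x < \<eta> \<and> gauge_transversal W X p"
    unfolding x_def
    by (intro eventually_conj tendstoD gauge_fix_tendsto eventually_gauge_transversal nz \<eta>)
  then obtain R0 where R0: "0 < R0"
    "\<And>p. dist p x < R0 \<Longrightarrow> dist (gauge_fix W X p) x < \<eta> \<and> gauge_transversal W X p"
    unfolding eventually_nhds_metric by blast
  have near: "dist (gauge_fix W X p) x < \<eta>" "gauge_transversal W X p" if "p \<in> cball x (R0 / 2)" for p
    using R0 that by (auto simp: dist_commute)
  define C where "C = (3 * N + 4) * (2 / m)\<^sup>2"
  show thesis
  proof (rule that[of "R0 / 2" C])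
    show "0 < R0 / 2" "0 < C" using R0 m N by (auto simp: C_def add_nonneg_pos)
    fix p assume p: "p \<in> cball x (R0 / 2)"
    have "dim (range (F_asym_deriv p)) \<le> dim (gauge_slice W X :: ((real^'r^'d1) \<times> (real^'r^'d2) \<times> (real^'r^'d3)) set)"
      unfolding range_F_asym_deriv_eq_slice[OF near(2)[OF p]]
      by (rule dim_image_le) (rule linear_F_asym_deriv)
    then show "dim (range (F_asym_deriv p)) \<le> (CARD('d1) + CARD('d2) + CARD('d3) - 2) * CARD('r)"
      by (simp add: dim_gauge_slice nz)
    define g where "g = gauge_fix W X p"
    define h where "h = g - x"
    define D where "D = norm (F_asym p - F_asym x)"
    have Fg: "F_asym g = F_asym p"
      unfolding g_def by (rule F_asym_gauge_fix[OF near(2)[OF p] nz])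
    have h: "h \<in> gauge_slice W X" "norm h \<le> \<eta>"
      using gauge_fix_in_slice[OF near(2)[OF p]] near(1)[OF p] unfolding h_def g_def x_def
      by (auto simp: dist_norm)
    have "m * norm h \<le> norm (F_asym_deriv x h)"
      by (rule m(2)[OF h(1)])
    also have "\<dots> \<le> D + norm (F_asym g - F_asym x - F_asym_deriv x h)"
      unfolding D_def Fg by norm
    also have "\<dots> \<le> D + (3 * norm x + norm h) * (norm h)\<^sup>2"
      using F_asym_Taylor[of x h] by (simp add: h_def)
    also have "\<dots> \<le> D + m / 2 * norm h"
    proof -
      have "(3 * norm x + norm h) * norm h \<le> (3 * N + 1) * \<eta>"
        using h(2) \<eta> N by (intro mult_mono) (auto simp: N_def)
      then have "(3 * norm x + norm h) * norm h \<le> m / 2"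
        using \<eta>(3) by linarith
      then have "(3 * norm x + norm h) * norm h * norm h \<le> m / 2 * norm h"
        by (intro mult_right_mono) auto
      then show ?thesis by (simp add: power2_eq_square mult.assoc)
    qed
    finally have hD: "norm h \<le> 2 / m * D"
      using m(1) by (simp add: field_simps)
    have "norm (F_asym (g + (- h)) - F_asym g - F_asym_deriv g (- h)) \<le> (3 * norm g + norm (- h)) * (norm (- h))\<^sup>2"
      by (rule F_asym_Taylor)
    also have "F_asym (g + (- h)) - F_asym g - F_asym_deriv g (- h) = - (F_asym p - F_asym x - F_asym_deriv g h)"
      by (simp add: h_def Fg linear_neg[OF linear_F_asym_deriv] linear_diff[OF linear_F_asym_deriv])
    finally have "norm (F_asym p - F_asym x - F_asym_deriv g h) \<le> (3 * norm g + norm h) * (norm h)\<^sup>2"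
      by (simp add: norm_minus_cancel del: minus_diff_eq)
    also have "\<dots> \<le> (3 * N + 4) * (2 / m * D)\<^sup>2"
    proof (intro mult_mono power_mono hD)
      have "norm g \<le> N + norm h"
        unfolding N_def h_def by norm
      then show "3 * norm g + norm h \<le> 3 * N + 4"
        using h(2) \<eta>(2) by linarith
    qed (use N in auto)
    also have "\<dots> = C * D\<^sup>2"
      by (simp add: C_def power_mult_distrib power_divide)
    finally have "norm (F_asym p - F_asym x - F_asym_deriv g h) \<le> C * D\<^sup>2" .
    moreover have "F_asym_deriv g h \<in> range (F_asym_deriv p)"
      using range_F_asym_deriv_gauge_fix unfolding g_def by blast
    ultimately show "\<exists>t\<in>range (F_asym_deriv p).
       norm (F_asym p - F_asym x - t) \<le> C * (norm (F_asym p - F_asym x))\<^sup>2"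
      unfolding D_def by blast
  qed
qed

theorem theorem5p17:
  fixes Wstar :: "real^'r^'d1" and Xstar :: "real^'r^'d2" and Ystar :: "real^'r^'d3"
    and xstar :: "(real^'r^'d1) \<times> (real^'r^'d2) \<times> (real^'r^'d3)"
    and Nstar sigmastar :: real
  assumes "rank Wstar = CARD('r)" and "rank Xstar = CARD('r)" and "rank Ystar = CARD('r)"
    and "xstar = (Wstar, Xstar, Ystar)"
    and "Nstar = norm xstar"
    and "sigmastar =
           singular_value ((CARD('d1) + CARD('d2) + CARD('d3) - 2) * CARD('r)) (deriv_at F_asym xstar)"
  shows "continuously_differentiable
           (F_asym :: (real^'r^'d1) \<times> (real^'r^'d2) \<times> (real^'r^'d3) \<Rightarrow> real^'d3^'d2^'d1) \<and>
         (\<forall>p\<in>cball xstar Nstar. \<forall>q\<in>cball xstar Nstar.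
           onorm (\<lambda>h. deriv_at F_asym p h - deriv_at F_asym q h) \<le> 4 * sqrt 3 * Nstar * norm (p - q)) \<and>
         (\<exists>R>0. \<exists>C>0. \<forall>u \<sigma> v. svd_choice F_asym u \<sigma> v \<longrightarrow>
           (let \<epsilon> = min R (min (sigmastar / (8 * sqrt 3 * Nstar)) Nstar);
                \<delta> = (\<lambda>\<rho>. \<rho> / C)
            in locally_strongly_aligned F_asym u \<sigma> xstar \<delta> \<epsilon> ((sigmastar / 2)\<^sup>2) \<and>
               (1 / 2 < sigmastar \<longrightarrow>
                  locally_strongly_aligned F_asym u \<sigma> xstar \<delta> \<epsilon> (sigmastar / 2))))"
proof (intro conjI)
  note rank = assms(1-3)
  note xs = assms(4)
  let ?k = "(CARD('d1) + CARD('d2) + CARD('d3) - 2) * CARD('r)"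
  let ?x = "(Wstar, Xstar, Ystar)"
  note nz = full_rank_column_nonzero[OF rank(1)] full_rank_column_nonzero[OF rank(2)]
  show "continuously_differentiable
           (F_asym :: (real^'r^'d1) \<times> (real^'r^'d2) \<times> (real^'r^'d3) \<Rightarrow> real^'d3^'d2^'d1)"
    by (rule continuously_differentiable_F_asym)
  have N: "0 < Nstar"
  proof -
    have "Wstar \<noteq> 0"
      using nz(1)[of undefined] by (auto simp: column_def vec_eq_iff)
    then show ?thesis
      by (simp add: assms(5) xs zero_prod_def)
  qed
  have Lip: "norm (F_asym_deriv p h - F_asym_deriv q h) \<le> 4 * sqrt 3 * Nstar * norm (p - q) * norm h"
    if "p \<in> cball xstar Nstar" "q \<in> cball xstar Nstar" for p q h
  proof -
    have "norm p \<le> 2 * Nstar" if "p \<in> cball xstar Nstar" for p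
      using that assms(5) norm_triangle_sub[of p xstar] by (simp add: dist_norm norm_minus_commute)
    then show ?thesis
      using F_asym_deriv_Lipschitz[of p "2 * Nstar" q h] that by simp
  qed
  show "\<forall>p\<in>cball xstar Nstar. \<forall>q\<in>cball xstar Nstar.
           onorm (\<lambda>h. deriv_at F_asym p h - deriv_at F_asym q h) \<le> 4 * sqrt 3 * Nstar * norm (p - q)"
    unfolding deriv_at_F_asym
    by (intro ballI onorm_bound Lip) (use N in auto)
  obtain m where m: "0 < m"
    "\<And>h. h \<in> gauge_slice Wstar Xstar \<Longrightarrow> m * norm h \<le> norm (F_asym_deriv xstar h)"
    unfolding xs using F_asym_deriv_expanding_on_slice[OF rank] by blast
  obtain R0 C where R0: "0 < R0" and C: "0 < C"
    and dim_range: "\<And>p. p \<in> cball xstar R0 \<Longrightarrow> dim (range (F_asym_deriv p)) \<le> ?k"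
    and tangent: "\<And>p. p \<in> cball xstar R0 \<Longrightarrow> \<exists>t\<in>range (F_asym_deriv p).
       norm (F_asym p - F_asym xstar - t) \<le> C * (norm (F_asym p - F_asym xstar))\<^sup>2"
    unfolding xs using F_asym_secant_near_tangent[OF rank] by metis
  let ?S = "gauge_slice Wstar Xstar :: ((real^'r^'d1) \<times> (real^'r^'d2) \<times> (real^'r^'d3)) set"
  have dimS: "dim ?S = ?k"
    using nz by (rule dim_gauge_slice)
  \<comment> \<open>The derivative is injective on the slice, whence the target has at least as many dimensions.\<close>
  have k: "?k \<in> {1..min (DIM((real^'r^'d1) \<times> (real^'r^'d2) \<times> (real^'r^'d3))) (DIM(real^'d3^'d2^'d1))}"
  proof -
    have "inj_on (F_asym_deriv xstar) (span ?S)"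
      unfolding span_eq_iff[THEN iffD2, OF subspace_gauge_slice] xs
      using linear_injective_on_subspace_0[OF linear_F_asym_deriv subspace_gauge_slice]
        F_asym_deriv_inj_on_slice[OF rank] by blast
    then have "dim (F_asym_deriv xstar ` ?S) = dim ?S"
      by (intro dim_image_eq linear_F_asym_deriv)
    then have "?k \<le> DIM(real^'d3^'d2^'d1)"
      using dim_subset_UNIV[of "F_asym_deriv xstar ` ?S"] dimS by simp
    moreover have "?k \<le> DIM((real^'r^'d1) \<times> (real^'r^'d2) \<times> (real^'r^'d3))"
      using dim_subset_UNIV[of ?S] dimS by simp
    moreover have "1 \<le> ?k"
    proof -
      have "0 < CARD('d1)" "0 < CARD('d2)" "0 < CARD('d3)" "0 < CARD('r)" by auto
      then have "0 < CARD('d1) + CARD('d2) + CARD('d3) - 2" by linarith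
      then show ?thesis using \<open>0 < CARD('r)\<close> by (simp add: Suc_le_eq)
    qed
    ultimately show ?thesis by simp
  qed
  have sigma: "sigmastar = \<sigma> xstar ?k" if "svd_choice F_asym u \<sigma> v" for u \<sigma> v
    using that singular_value_eq[OF _ k] unfolding svd_choice_def assms(6) by blast
  show "\<exists>R>0. \<exists>C>0. \<forall>u \<sigma> v. svd_choice F_asym u \<sigma> v \<longrightarrow>
           (let \<epsilon> = min R (min (sigmastar / (8 * sqrt 3 * Nstar)) Nstar);
                \<delta> = (\<lambda>\<rho>. \<rho> / C)
            in locally_strongly_aligned F_asym u \<sigma> xstar \<delta> \<epsilon> ((sigmastar / 2)\<^sup>2) \<and>
               (1 / 2 < sigmastar \<longrightarrow>
                  locally_strongly_aligned F_asym u \<sigma> xstar \<delta> \<epsilon> (sigmastar / 2)))"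
  \<comment> \<open>A singular value decomposition is what links \<open>sigmastar\<close> to the derivative and makes it
      positive, and \<open>R\<close> is built from it; if there is no choice of decompositions, the claim is empty.\<close>
  proof (cases "\<exists>u \<sigma> v. svd_choice (F_asym :: (real^'r^'d1) \<times> (real^'r^'d2) \<times> (real^'r^'d3) \<Rightarrow> real^'d3^'d2^'d1) u \<sigma> v")
    case False
    then show ?thesis by (metis zero_less_one)
  next
    case True
    then obtain u0 \<sigma>0 v0 where svd0:
      "svd_choice (F_asym :: (real^'r^'d1) \<times> (real^'r^'d2) \<times> (real^'r^'d3) \<Rightarrow> real^'d3^'d2^'d1) u0 \<sigma>0 v0"
      by blast
    have "is_svd (F_asym_deriv xstar) (u0 xstar) (\<sigma>0 xstar) (v0 xstar)"
      using svd0 unfolding svd_choice_def deriv_at_F_asym by blast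
    then have "m \<le> \<sigma>0 xstar ?k"
      using k subspace_gauge_slice dimS[symmetric, THEN eq_refl] m(2)
      by (rule svd_ge_if_expanding[where S = ?S])
    then have s: "0 < sigmastar"
      using m(1) sigma[OF svd0] by simp
    \<comment> \<open>The target lower bound for the singular value near \<open>xstar\<close>. It lies strictly below \<open>sigmastar\<close>,
        and \<open>\<theta>\<^sup>2\<close> reaches each claimed threshold; for \<open>sigmastar / 2\<close> there is room because
        \<open>sigmastar / 2 < sigmastar\<^sup>2\<close> exactly when \<open>1 / 2 < sigmastar\<close>.\<close>
    define \<theta> where "\<theta> = (if 1 / 2 < sigmastar then max (sigmastar / 2) (sqrt (sigmastar / 2)) else sigmastar / 2)"
    have "sqrt (sigmastar / 2) < sigmastar" if "1 / 2 < sigmastar"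
    proof (rule real_less_lsqrt)
      show "sigmastar / 2 < sigmastar\<^sup>2"
        using that mult_strict_right_mono[OF that s] by (simp add: power2_eq_square)
    qed (use s in auto)
    then have \<theta>: "0 < \<theta>" "\<theta> < sigmastar"
      using s by (auto simp: \<theta>_def)
    \<comment> \<open>Within this radius Weyl's inequality lowers the singular value by at most \<open>sigmastar - \<theta>\<close>.\<close>
    define R where "R = min R0 ((sigmastar - \<theta>) / (4 * sqrt 3 * Nstar))"
    define \<epsilon> where "\<epsilon> = min R (min (sigmastar / (8 * sqrt 3 * Nstar)) Nstar)"
    have R: "0 < R" using R0 \<theta> N by (auto simp: R_def)
    have \<epsilon>: "0 < \<epsilon>" using R s N by (auto simp: \<epsilon>_def)
    have aligned: "locally_strongly_aligned F_asym u \<sigma> xstar (\<lambda>\<rho>. \<rho> / C) \<epsilon> s"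
      if svd: "svd_choice F_asym u \<sigma> v" and s: "0 < s" "s \<le> \<theta>\<^sup>2" for u \<sigma> v s
      unfolding locally_strongly_aligned_def
    proof (intro conjI allI impI)
      fix \<rho> :: real and p
      assume \<rho>: "0 < \<rho>" and "p \<in> cball xstar \<epsilon> \<and> F_asym p \<in> cball (F_asym xstar) (\<rho> / C)"
      then have p: "p \<in> cball xstar \<epsilon>" and z: "norm (F_asym p - F_asym xstar) \<le> \<rho> / C"
        by (auto simp: dist_norm norm_minus_commute)
      have pR0: "p \<in> cball xstar R0" and pN: "p \<in> cball xstar Nstar"
        and pR: "norm (xstar - p) \<le> (sigmastar - \<theta>) / (4 * sqrt 3 * Nstar)"
        using p by (auto simp: \<epsilon>_def R_def dist_norm)
      have svds: "is_svd (F_asym_deriv q) (u q) (\<sigma> q) (v q)" for q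
        using svd unfolding svd_choice_def deriv_at_F_asym by blast
      have "\<sigma> xstar ?k - 4 * sqrt 3 * Nstar * norm (xstar - p) \<le> \<sigma> p ?k"
        using N by (intro svd_Weyl[OF svds svds k] Lip pN) auto
      moreover have "4 * sqrt 3 * Nstar * norm (xstar - p) \<le> sigmastar - \<theta>"
        using pR N by (simp add: field_simps)
      ultimately have \<sigma>: "\<theta> \<le> \<sigma> p ?k"
        using sigma[OF svd] by linarith
      obtain t where t: "t \<in> range (F_asym_deriv p)"
        "norm (F_asym p - F_asym xstar - t) \<le> C * (norm (F_asym p - F_asym xstar))\<^sup>2"
        using tangent[OF pR0] by blast
      have "t \<in> span (u p ` {1..?k})"
        using range_subset_span_left_vectors[OF svds k linear_F_asym_deriv _ dim_range[OF pR0]]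
          \<sigma> \<theta>(1) t(1) by force
      then have "norm ((F_asym p - F_asym xstar)
          - orthogonal_projection (span (u p ` {1..?k})) (F_asym p - F_asym xstar))
          \<le> norm (F_asym p - F_asym xstar - t)"
        by (intro orthogonal_projection_residual_le) auto
      also have "\<dots> \<le> (C * norm (F_asym p - F_asym xstar)) * norm (F_asym p - F_asym xstar)"
        using t(2) by (simp add: power2_eq_square mult.assoc)
      also have "\<dots> \<le> \<rho> * norm (F_asym p - F_asym xstar)"
        using z C by (intro mult_right_mono) (auto simp: field_simps)
      finally have "norm ((F_asym p - F_asym xstar)
          - orthogonal_projection (span (u p ` {1..?k})) (F_asym p - F_asym xstar))
          \<le> \<rho> * norm (F_asym p - F_asym xstar)" .
      moreover have "s \<le> (\<sigma> p ?k)\<^sup>2"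
        using s(2) power_mono[OF \<sigma>, of 2] \<theta>(1) by linarith
      ultimately show "\<exists>j\<in>{1..min (DIM((real^'r^'d1) \<times> (real^'r^'d2) \<times> (real^'r^'d3))) (DIM(real^'d3^'d2^'d1))}.
          norm ((F_asym p - F_asym xstar) - orthogonal_projection (span (u p ` {1..j})) (F_asym p - F_asym xstar))
            \<le> \<rho> * norm (F_asym p - F_asym xstar) \<and> s \<le> (\<sigma> p j)\<^sup>2"
        using k by blast
    qed (use \<epsilon> s C in auto)
    have "(sigmastar / 2)\<^sup>2 \<le> \<theta>\<^sup>2"
      using s by (intro power_mono) (auto simp: \<theta>_def)
    moreover have "sigmastar / 2 \<le> \<theta>\<^sup>2" if "1 / 2 < sigmastar"
    proof -
      have "(sqrt (sigmastar / 2))\<^sup>2 \<le> \<theta>\<^sup>2"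
        using s that by (intro power_mono) (auto simp: \<theta>_def)
      then show ?thesis using s by simp
    qed
    ultimately show ?thesis
      using R C aligned s unfolding Let_def \<epsilon>_def
      by (intro exI[of _ R] conjI[OF R] exI[of _ C] conjI[OF C] allI impI conjI) simp_all
  qed
qed

end
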